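(* Let $\mathbf{k}$ be a field, let $(A,\cdot,\circ)$ be a Jacobi Novikov-Poisson algebra over $\mathbf{k}$ and let $u$ be a fixed element of $A$. Then $(A,\cdot,\circ_u)$ is a Jacobi Novikov-Poisson algebra, where the binary operation $\circ_u$ is given by $$a\circ_u b:=a\circ(u\cdot b)\qquad\text{for all } a,b\in A.$$
   Context: Binary operations are bilinear. A Novikov algebra $(A,\circ)$ is a vector space with a binary operation satisfying $(a\circ b)\circ c-a\circ(b\circ c)=(b\circ a)\circ c-b\circ(a\circ c)$ and $(a\circ b)\circ c=(a\circ c)\circ b$ for all $a,b,c\in A$. A Jacobi Novikov-Poisson algebra is a triple $(A,\cdot,\circ)$ where $(A,\cdot)$ is a unital commutative associative algebra with identity $1_A$, $(A,\circ)$ is a Novikov algebra, and for all $a,b,c\in A$: $(a\cdot b)\circ c=a\cdot(b\circ c)$ and $c\circ(a\cdot b)=(c\circ a)\cdot b+a\cdot(c\circ b)-a\cdot b\cdot(c\circ 1_A)$. *)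

theory Defs
  imports Complex_Main
begin

locale bilinear_algebra = vector_space scale
  for scale :: "'k::field \<Rightarrow> 'a::ab_group_add \<Rightarrow> 'a" +
  fixes mul :: "'a \<Rightarrow> 'a \<Rightarrow> 'a"
  assumes linear_left: "Vector_Spaces.linear scale scale (\<lambda>a. mul a b)"
    and linear_right: "Vector_Spaces.linear scale scale (\<lambda>b. mul a b)"

locale novikov_algebra = bilinear_algebra scale circ
  for scale :: "'k::field \<Rightarrow> 'a::ab_group_add \<Rightarrow> 'a"
    and circ :: "'a \<Rightarrow> 'a \<Rightarrow> 'a" +
  assumes left_symmetric:
      "circ (circ a b) c - circ a (circ b c) = circ (circ b a) c - circ b (circ a c)"
    and right_commutative: "circ (circ a b) c = circ (circ a c) b"

text \<open>
  The identity is an explicit parameter, determined by \<open>dot\<close>; \<open>one = 0\<close> (the zero algebra) is allowed.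
\<close>

locale unital_comm_assoc_algebra =
  bilinear_algebra scale dot + dot: comm_monoid dot one
  for scale :: "'k::field \<Rightarrow> 'a::ab_group_add \<Rightarrow> 'a"
    and dot :: "'a \<Rightarrow> 'a \<Rightarrow> 'a" and one :: 'a

locale jacobi_novikov_poisson_algebra =
  dot: unital_comm_assoc_algebra scale dot one + circ: novikov_algebra scale circ
  for scale :: "'k::field \<Rightarrow> 'a::ab_group_add \<Rightarrow> 'a"
    and dot :: "'a \<Rightarrow> 'a \<Rightarrow> 'a" and one :: 'a
    and circ :: "'a \<Rightarrow> 'a \<Rightarrow> 'a" +
  assumes dot_circ: "circ (dot a b) c = dot a (circ b c)"
    and circ_dot: "circ c (dot a b) =
      dot (circ c a) b + dot a (circ c b) - dot (dot a b) (circ c one)"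

end

theory Submission
  imports Defs
begin

text \<open>
  Since \<open>(a \<cdot> b) \<circ> c = a \<cdot> (b \<circ> c)\<close>, the operation \<open>\<circ>\<close> is determined by the single linear map
  \<open>D b = 1 \<circ> b\<close> through \<open>a \<circ> b = a \<cdot> D b\<close>, and the second compatibility law becomes
  the generalized Leibniz rule \<open>D (a \<cdot> b) = D a \<cdot> b + a \<cdot> D b - a \<cdot> b \<cdot> D 1\<close>.
  Conversely, every linear map obeying this rule gives a Jacobi Novikov-Poisson algebra
  (\<open>generalized_derivation_jacobi_novikov_poisson\<close>): right commutativity is commutativity of
  the product, and by the Leibniz rule the associator of \<open>a, b, c\<close> equals
  \<open>- a \<cdot> b \<cdot> (D (D c) - D c \<cdot> D 1)\<close>, which is symmetric in \<open>a\<close> and \<open>b\<close>.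

  Passing from \<open>\<circ>\<close> to \<open>\<circ>\<^sub>u\<close> replaces \<open>D\<close> by \<open>D\<^sub>u b = D (u \<cdot> b)\<close>. It therefore suffices to check
  the Leibniz rule for \<open>D\<^sub>u\<close>, with correction term \<open>D\<^sub>u 1 = D u\<close>, and this follows by expanding
  both \<open>D (u \<cdot> a \<cdot> b)\<close> and \<open>D (u \<cdot> b)\<close> with the rule for \<open>D\<close>.
\<close>

context bilinear_algebra
begin

lemma mul_add_left: "mul (a + b) c = mul a c + mul b c"
  and mul_diff_left: "mul (a - b) c = mul a c - mul b c"
proof -
  interpret l: Vector_Spaces.linear scale scale "\<lambda>a. mul a c" by (rule linear_left)
  show "mul (a + b) c = mul a c + mul b c" by (rule l.add)
  show "mul (a - b) c = mul a c - mul b c" by (rule l.diff)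
qed

lemma mul_add_right: "mul c (a + b) = mul c a + mul c b"
  and mul_diff_right: "mul c (a - b) = mul c a - mul c b"
proof -
  interpret l: Vector_Spaces.linear scale scale "\<lambda>a. mul c a" by (rule linear_right)
  show "mul c (a + b) = mul c a + mul c b" by (rule l.add)
  show "mul c (a - b) = mul c a - mul c b" by (rule l.diff)
qed

end

text \<open>
  Left symmetry is the only law that is not immediate. The terms \<open>a \<cdot> D b \<cdot> D c\<close> cancel in the
  associator, and every remaining summand contains \<open>a\<close> and \<open>b\<close> only through \<open>a \<cdot> b\<close>.
\<close>

lemma (in unital_comm_assoc_algebra) generalized_derivation_jacobi_novikov_poisson:
  assumes lin: "Vector_Spaces.linear scale scale D"
    and leibniz: "\<And>a b. D (dot a b) = dot (D a) b + dot a (D b) - dot (dot a b) (D one)"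
  shows "jacobi_novikov_poisson_algebra scale dot one (\<lambda>a b. dot a (D b))"
proof -
  note dot_ac = dot.assoc dot.commute dot.left_commute
  note dot_distribs = mul_add_left mul_diff_left mul_add_right mul_diff_right
  have assoc: "dot (dot a (D b)) (D c) - dot a (D (dot b (D c)))
      = - dot (dot a b) (D (D c) - dot (D c) (D one))" for a b c
    by (simp add: leibniz dot_distribs dot_ac)
  show ?thesis
  proof (intro jacobi_novikov_poisson_algebra.intro jacobi_novikov_poisson_algebra_axioms.intro
      novikov_algebra.intro novikov_algebra_axioms.intro
      bilinear_algebra.intro bilinear_algebra_axioms.intro)
    show "unital_comm_assoc_algebra scale dot one" by (rule unital_comm_assoc_algebra_axioms)
    show "vector_space scale" by (rule vector_space_axioms)
    fix a b c
    show "Vector_Spaces.linear scale scale (\<lambda>a. dot a (D b))"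
      by (rule linear_left)
    show "Vector_Spaces.linear scale scale (\<lambda>b. dot a (D b))"
      using Vector_Spaces.linear_compose[OF lin linear_right[of a]] by (simp add: o_def)
    show "dot (dot a (D b)) (D c) - dot a (D (dot b (D c)))
        = dot (dot b (D a)) (D c) - dot b (D (dot a (D c)))"
      by (simp only: assoc dot.commute[of b a])
    show "dot (dot a (D b)) (D c) = dot (dot a (D c)) (D b)"
      by (simp add: dot_ac)
    show "dot (dot a b) (D c) = dot a (dot b (D c))"
      by (rule dot.assoc)
    show "dot c (D (dot a b)) =
        dot (dot c (D a)) b + dot a (dot c (D b)) - dot (dot a b) (dot c (D one))"
      by (simp add: leibniz dot_distribs dot_ac)
  qed
qed

theorem proposition2p18:
  fixes scale :: "'k::field \<Rightarrow> 'a::ab_group_add \<Rightarrow> 'a"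
    and dot circ :: "'a \<Rightarrow> 'a \<Rightarrow> 'a"
    and one u :: 'a
  assumes "jacobi_novikov_poisson_algebra scale dot one circ"
  shows "jacobi_novikov_poisson_algebra scale dot one (\<lambda>a b. circ a (dot u b))"
proof -
  interpret jacobi_novikov_poisson_algebra scale dot one circ by (rule assms)
  define D where "D = circ one"
  have circ_eq: "circ a b = dot a (D b)" for a b
    using dot_circ[of a one b] by (simp add: D_def)
  have leibniz: "D (dot a b) = dot (D a) b + dot a (D b) - dot (dot a b) (D one)" for a b
    unfolding D_def by (rule circ_dot)
  have "Vector_Spaces.linear scale scale (\<lambda>b. D (dot u b))"
    using Vector_Spaces.linear_compose[OF dot.linear_right[of u] circ.linear_right[of one]]
    by (simp add: D_def o_def)
  moreover have "D (dot u (dot a b)) =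
      dot (D (dot u a)) b + dot a (D (dot u b)) - dot (dot a b) (D (dot u one))" for a b
  proof -
    have "D (dot u (dot a b)) =
        dot (D (dot u a)) b + (dot (dot u a) (D b) - dot (dot (dot u a) b) (D one))"
      using leibniz[of "dot u a" b] by (simp add: dot.dot.assoc add_diff_eq)
    \<comment> \<open>Expanding \<open>D (u \<cdot> b)\<close> and multiplying by \<open>a\<close>, the summand \<open>a \<cdot> b \<cdot> D u\<close> is exactly the
      new correction term.\<close>
    also have "dot (dot u a) (D b) - dot (dot (dot u a) b) (D one)
        = dot a (D (dot u b)) - dot (dot a b) (D (dot u one))"
      by (simp add: leibniz dot.mul_add_right dot.mul_diff_right
          dot.dot.assoc dot.dot.commute dot.dot.left_commute)
    finally show ?thesis by (simp add: add_diff_eq)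
  qed
  ultimately show ?thesis
    unfolding circ_eq by (rule dot.generalized_derivation_jacobi_novikov_poisson)
qed

end
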